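(* Let $P_n(x)$ and $Q_n(x)$, $n\ge 0$, be the polynomials such that, for all $n \ge 0$, $$\mathrm{Ai}^{(n)}(x)=P_n(x)\,\mathrm{Ai}(x)+Q_n(x)\,\mathrm{Ai}'(x),\qquad \mathrm{Bi}^{(n)}(x)=P_n(x)\,\mathrm{Bi}(x)+Q_n(x)\,\mathrm{Bi}'(x).$$ For integers $m,n\ge 0$ put $$\tilde g_{m,n}=\frac{1}{(\sqrt 3)^{n}}\,C_n^{m+1}\!\left(\frac{\sqrt 3}{2}\right),$$ and put $\tilde g_{m,-1}=0$. Then for every integer $n\ge 0$ $$Q_{n+1}(x)=\sum_{\frac n3\le m\le \frac n2}\tilde g_{m,n-2m}\,\frac{m!\,x^{3m-n}}{(3m-n)!},$$ $$P_n(x)=\sum_{\frac n3\le m\le \frac n2}\bigl\{\tilde g_{m,n-2m}-\tilde g_{m,n-2m-1}\bigr\}\,\frac{m!\,x^{3m-n}}{(3m-n)!},$$ where both sums run over integers $m$.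
   Context: $\mathrm{Ai}$ and $\mathrm{Bi}$ are the standard Airy functions, two linearly independent solutions of $y''=xy$; the superscript $(n)$ denotes the $n$-th derivative. The index $n$ of $P_n,Q_n$ is the derivative order, not the degree. Equivalently, $P_n,Q_n$ are determined by $P_0=1$, $Q_0=0$ and $P_{n+1}(x)=P_n'(x)+xQ_n(x)$, $Q_{n+1}(x)=P_n(x)+Q_n'(x)$. $C_n^{\lambda}(x)$ denotes the Gegenbauer polynomial, defined by the generating function $\sum_{n\ge0}C_n^\lambda(x)t^n=(1-2xt+t^2)^{-\lambda}$; thus $\tilde g_{m,n}$ is the coefficient of $t^n$ in the power series of $\bigl(1-t+\tfrac13t^2\bigr)^{-(m+1)}$. An empty sum is $0$. *)

theory Defs
  imports "HOL-Analysis.Analysis" "HOL-Computational_Algebra.Computational_Algebra"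
begin

text \<open>
  The Airy functions are given by their Maclaurin series. The functions \<open>airy_f\<close> and \<open>airy_g\<close>
  are the solutions of \<open>y'' = x y\<close> with \<open>(y(0), y'(0)) = (1, 0)\<close> and \<open>(0, 1)\<close>; here
  \<open>3^k * pochhammer (1/3) k = 1 * 4 * \<dots> * (3 * k - 2)\<close> and
  \<open>3^k * pochhammer (2/3) k = 2 * 5 * \<dots> * (3 * k - 1)\<close>.
  As for \<open>exp\<close> and \<open>sin\<close>, the type class covers both the real and the complex functions.
\<close>

definition airy_f :: "'a::{real_normed_field,banach} \<Rightarrow> 'a" where
  "airy_f x = (\<Sum>k. 3 ^ k * pochhammer (1 / 3) k * x ^ (3 * k) / fact (3 * k))"

definition airy_g :: "'a::{real_normed_field,banach} \<Rightarrow> 'a" where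
  "airy_g x = (\<Sum>k. 3 ^ k * pochhammer (2 / 3) k * x ^ (3 * k + 1) / fact (3 * k + 1))"

text \<open>The coefficients are the standard values of \<open>Ai\<close>, \<open>Ai'\<close>, \<open>Bi\<close>, \<open>Bi'\<close> at \<open>0\<close>.\<close>

definition Ai :: "'a::{real_normed_field,banach} \<Rightarrow> 'a" where
  "Ai x = of_real (1 / (3 powr (2 / 3) * Gamma (2 / 3))) * airy_f x
        - of_real (1 / (3 powr (1 / 3) * Gamma (1 / 3))) * airy_g x"

definition Bi :: "'a::{real_normed_field,banach} \<Rightarrow> 'a" where
  "Bi x = of_real (1 / (3 powr (1 / 6) * Gamma (2 / 3))) * airy_f x
        + of_real (3 powr (1 / 6) / Gamma (1 / 3)) * airy_g x"

text \<open>
  The coefficient of \<open>t ^ n\<close> in \<open>(1 - 2 * x * t + t\<^sup>2) powr (- l)\<close>: \<open>fps_binomial (- l)\<close> is the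
  series of \<open>(1 + u) powr (- l)\<close>, in which \<open>u = t\<^sup>2 - 2 * x * t\<close> is substituted.
\<close>

definition gegenbauer :: "nat \<Rightarrow> 'a::field_char_0 \<Rightarrow> 'a \<Rightarrow> 'a" where
  "gegenbauer n l x =
     fps_nth (fps_compose (fps_binomial (- l)) (fps_X ^ 2 - fps_const (2 * x) * fps_X)) n"

text \<open>The second index is an integer because the value \<open>-1\<close> occurs.\<close>

definition g_tilde :: "nat \<Rightarrow> int \<Rightarrow> real" where
  "g_tilde m n =
     (if n < 0 then 0
      else 1 / sqrt 3 ^ nat n * gegenbauer (nat n) (real m + 1) (sqrt 3 / 2))"

end

theory Submission imports Defs
begin

text \<open>
  The Wronskian of \<open>Ai\<close> and \<open>Bi\<close> never vanishes, so the polynomials are unique and satisfy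
  \<open>P (n + 1) = P n' + x Q n\<close>, \<open>Q (n + 1) = P n + Q n'\<close>. Comparing coefficients, the claimed
  formulas satisfy the second recurrence trivially, and the first one amounts to
  \<open>m (g (m, j) - 2 g (m, j - 1) + g (m, j - 2)) = (m - j) g (m - 1, j)\<close>. With
  \<open>\<phi> = 1 - t + t\<^sup>2 / 3\<close> this is the coefficient of \<open>t ^ j\<close> in
  \<open>m (1 - t)\<^sup>2 \<phi> ^ (- m - 1) = (m - t d/dt) \<phi> ^ (- m)\<close>, which holds because
  \<open>\<phi> + t \<phi>' = (1 - t)\<^sup>2\<close>.
\<close>

section \<open>Airy series\<close>

text \<open>The hypotheses \<open>c2\<close> and \<open>rec\<close> are y'' = x y read off
  coefficientwise: the constant term of y'' is 0, and its coefficient at x^(n + 1) is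
  \<open>c n\<close>. Hence the twice differentiated series is the original one shifted by one
  place.\<close>

lemma airy_power_series:
  fixes c :: "nat \<Rightarrow> 'a::{real_normed_field,banach}"
  assumes sm: "\<And>x. summable (\<lambda>n. c n * x ^ n)"
    and c2: "c 2 = 0"
    and rec: "\<And>n. of_nat (n + 3) * of_nat (n + 2) * c (n + 3) = c n"
  shows "((\<lambda>x. \<Sum>n. c n * x ^ n) has_field_derivative (\<Sum>n. diffs c n * x ^ n)) (at x)"
    and "((\<lambda>x. \<Sum>n. diffs c n * x ^ n) has_field_derivative x * (\<Sum>n. c n * x ^ n)) (at x)"
proof -
  show "((\<lambda>x. \<Sum>n. c n * x ^ n) has_field_derivative (\<Sum>n. diffs c n * x ^ n)) (at x)"
    by (rule termdiffs_strong_converges_everywhere) (rule sm)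
  have sm1: "summable (\<lambda>n. diffs c n * x ^ n)" for x
    by (rule termdiff_converges_all) (rule sm)
  have sm2: "summable (\<lambda>n. diffs (diffs c) n * x ^ n)" for x
    by (rule termdiff_converges_all) (rule sm1)
  have D: "((\<lambda>x. \<Sum>n. diffs c n * x ^ n) has_field_derivative (\<Sum>n. diffs (diffs c) n * x ^ n)) (at x)"
    by (rule termdiffs_strong_converges_everywhere) (rule sm1)
  have 0: "diffs (diffs c) 0 = 0"
    using c2 by (simp add: diffs_def numeral_2_eq_2)
  have S: "diffs (diffs c) (Suc n) = c n" for n
    using rec[of n] by (simp add: diffs_def numeral_3_eq_3 algebra_simps)
  have "(\<Sum>n. diffs (diffs c) n * x ^ n) = (\<Sum>n. diffs (diffs c) (Suc n) * x ^ Suc n)"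
    using suminf_split_head[OF sm2[of x]] 0 by simp
  also have "\<dots> = (\<Sum>n. x * (c n * x ^ n))"
    by (simp add: S mult_ac)
  also have "\<dots> = x * (\<Sum>n. c n * x ^ n)"
    by (rule suminf_mult[OF sm])
  finally show "((\<lambda>x. \<Sum>n. diffs c n * x ^ n) has_field_derivative x * (\<Sum>n. c n * x ^ n)) (at x)"
    using D by simp
qed

text \<open>The Maclaurin coefficients over all exponents, with zeros outside one residue class mod
  3, so that termwise differentiation of power series applies. \<open>r = 0\<close> belongs to
  \<open>airy_f\<close> and \<open>r = 1\<close> to \<open>airy_g\<close>.\<close>

definition airy_coeff :: "nat \<Rightarrow> nat \<Rightarrow> 'a::{real_normed_field,banach}" where
  "airy_coeff r n =
     (if n mod 3 = r
      then 3 ^ (n div 3) * pochhammer (of_nat (r + 1) / 3) (n div 3) / fact n else 0)"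

lemma airy_coeff_2: "r < 2 \<Longrightarrow> airy_coeff r 2 = 0"
  by (simp add: airy_coeff_def)

lemma airy_coeff_rec:
  "of_nat (n + 3) * of_nat (n + 2) * airy_coeff r (n + 3)
     = (airy_coeff r n :: 'a::{real_normed_field,banach})"
proof (cases "n mod 3 = r")
  case True
  define k where "k = n div 3"
  have n: "n = 3 * k + r" using True mult_div_mod_eq[of 3 n] by (simp add: k_def)
  have A: "(n + 3) mod 3 = r" "(n + 3) div 3 = Suc k"
    using True by (simp_all add: k_def)
  have F: "fact (n + 3) = of_nat (n + 3) * of_nat (n + 2) * (of_nat (n + 1) * fact n :: 'a)"
    by (simp add: numeral_3_eq_3 numeral_2_eq_2 algebra_simps)
  \<comment> \<open>The new Pochhammer factor, together with the extra 3, is n + 1. It cancels one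
    of the three factors gained by the factorial.\<close>
  have N: "3 * (of_nat (r + 1) / 3 + of_nat k) = (of_nat (n + 1) :: 'a)"
    by (simp add: n field_simps)
  have nz: "of_nat (n + 3) \<noteq> (0::'a)" "of_nat (n + 2) \<noteq> (0::'a)" "of_nat (n + 1) \<noteq> (0::'a)"
    by (simp_all only: of_nat_eq_0_iff)
  have "airy_coeff r (n + 3) =
      (3 * (of_nat (r + 1) / 3 + of_nat k)) * (3 ^ k * pochhammer (of_nat (r + 1) / 3) k) /
        (fact (n + 3) :: 'a)"
    using A by (simp add: airy_coeff_def pochhammer_Suc algebra_simps)
  also have "\<dots> = of_nat (n + 1) * (3 ^ k * pochhammer (of_nat (r + 1) / 3) k) /
        (of_nat (n + 3) * of_nat (n + 2) * (of_nat (n + 1) * fact n))"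
    unfolding F N ..
  finally show ?thesis
    using nz True by (simp add: airy_coeff_def k_def del: of_nat_add)
next
  case False
  then show ?thesis by (simp add: airy_coeff_def)
qed

lemma strict_mono_3: "strict_mono (\<lambda>k::nat. 3 * k + r)"
  by (simp add: strict_mono_def)

lemma airy_coeff_outside:
  assumes "n \<notin> range (\<lambda>k. 3 * k + r)"
  shows "airy_coeff r n * x ^ n = 0"
proof -
  have "n mod 3 \<noteq> r"
    using assms by (metis mult_div_mod_eq rangeI)
  then show ?thesis by (simp add: airy_coeff_def)
qed

text \<open>The zero coefficients rule out the ratio test on the full series, so it is applied to
  the subseries \<open>h\<close> of exponents 3 k + r.\<close>

lemma summable_airy_coeff:
  assumes r: "r < 3"
  shows "summable (\<lambda>n. airy_coeff r n * (x::'a::{real_normed_field,banach}) ^ n)"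
proof -
  define h where "h k = airy_coeff r (3 * k + r) * x ^ (3 * k + r)" for k
  \<comment> \<open>By \<open>airy_coeff_rec\<close> consecutive terms of \<open>h\<close> have
    ratio |x|^3 / ((n + 3) (n + 2)) in norm, and n + 3 \<ge> N makes this at most 1/2.\<close>
  obtain N :: nat where N: "norm x ^ 3 * 2 \<le> real N"
    using real_arch_simple by blast
  have "norm (h (Suc k)) \<le> 1 / 2 * norm (h k)" if "k \<ge> N" for k
  proof -
    define n where "n = 3 * k + r"
    have 1: "h (Suc k) = airy_coeff r (n + 3) * x ^ (n + 3)" "h k = airy_coeff r n * x ^ n"
      by (simp_all add: h_def n_def algebra_simps)
    have "norm (h k) = norm (of_nat (n + 3) * of_nat (n + 2) * (airy_coeff r (n + 3) :: 'a) * x ^ n)"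
      unfolding 1 airy_coeff_rec ..
    also have "\<dots> = real (n + 3) * real (n + 2) * norm (airy_coeff r (n + 3) :: 'a) * norm x ^ n"
      by (simp only: norm_mult norm_of_nat norm_power)
    finally have hk: "norm (h k) =
        real (n + 3) * real (n + 2) * (norm (airy_coeff r (n + 3) :: 'a) * norm x ^ n)"
      by (simp add: mult_ac)
    have "norm x ^ 3 * 2 \<le> real (n + 3) * 1"
      using N that by (simp add: n_def)
    also have "\<dots> \<le> real (n + 3) * real (n + 2)"
      by (intro mult_left_mono) auto
    finally have "norm x ^ 3 * 2 * (norm (airy_coeff r (n + 3) :: 'a) * norm x ^ n) \<le> norm (h k)"
      unfolding hk by (intro mult_right_mono) auto
    moreover have "norm (h (Suc k)) = norm x ^ 3 * (norm (airy_coeff r (n + 3) :: 'a) * norm x ^ n)"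
      unfolding 1 by (simp add: norm_mult norm_power power_add mult_ac)
    ultimately show ?thesis by simp
  qed
  then have "summable h"
    by (intro summable_ratio_test[where c = "1/2" and N = N]) auto
  then show ?thesis
    unfolding h_def
    by (subst (asm) summable_mono_reindex[OF strict_mono_3, where f = "\<lambda>n. airy_coeff r n * x ^ n"])
       (auto simp: airy_coeff_outside)
qed

lemma suminf_airy_coeff:
  assumes r: "r < 3"
  shows "(\<Sum>n. airy_coeff r n * (x::'a::{real_normed_field,banach}) ^ n) =
    (\<Sum>k. 3 ^ k * pochhammer (of_nat (r + 1) / 3) k * x ^ (3 * k + r) / fact (3 * k + r))"
proof -
  have "(\<Sum>n. airy_coeff r n * x ^ n) = (\<Sum>k. airy_coeff r (3 * k + r) * x ^ (3 * k + r))"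
    by (rule suminf_mono_reindex[OF strict_mono_3, symmetric]) (rule airy_coeff_outside)
  also have "\<dots> = (\<Sum>k. 3 ^ k * pochhammer (of_nat (r + 1) / 3) k * x ^ (3 * k + r) / fact (3 * k + r))"
    using r by (intro suminf_cong) (simp add: airy_coeff_def)
  finally show ?thesis .
qed

lemma airy_f_eq: "airy_f = (\<lambda>x. \<Sum>n. airy_coeff 0 n * x ^ n)"
  by (rule ext, subst suminf_airy_coeff) (simp_all add: airy_f_def)

lemma airy_g_eq: "airy_g = (\<lambda>x. \<Sum>n. airy_coeff 1 n * x ^ n)"
  by (rule ext, subst suminf_airy_coeff) (simp_all add: airy_g_def)

definition airy_f' :: "'a::{real_normed_field,banach} \<Rightarrow> 'a" where
  "airy_f' x = (\<Sum>n. diffs (airy_coeff 0) n * x ^ n)"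

definition airy_g' :: "'a::{real_normed_field,banach} \<Rightarrow> 'a" where
  "airy_g' x = (\<Sum>n. diffs (airy_coeff 1) n * x ^ n)"

lemma DERIV_airy:
  fixes x :: "'a::{real_normed_field,banach}"
  shows "(airy_f has_field_derivative airy_f' x) (at x)"
    and "(airy_f' has_field_derivative x * airy_f x) (at x)"
    and "(airy_g has_field_derivative airy_g' x) (at x)"
    and "(airy_g' has_field_derivative x * airy_g x) (at x)"
proof -
  note ps = airy_power_series[OF summable_airy_coeff airy_coeff_2 airy_coeff_rec]
  show "(airy_f has_field_derivative airy_f' x) (at x)"
    unfolding airy_f_eq airy_f'_def by (rule ps(1)) auto
  show "(airy_g has_field_derivative airy_g' x) (at x)"
    unfolding airy_g_eq airy_g'_def by (rule ps(1)) auto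
  have e: "airy_f' = (\<lambda>x::'a. \<Sum>n. diffs (airy_coeff 0) n * x ^ n)"
    "airy_g' = (\<lambda>x::'a. \<Sum>n. diffs (airy_coeff 1) n * x ^ n)"
    by (simp_all add: fun_eq_iff airy_f'_def airy_g'_def)
  show "(airy_f' has_field_derivative x * airy_f x) (at x)"
    unfolding airy_f_eq e by (rule ps(2)) auto
  show "(airy_g' has_field_derivative x * airy_g x) (at x)"
    unfolding airy_g_eq e by (rule ps(2)) auto
qed

lemma airy_at_0:
  "airy_f 0 = (1::'a::{real_normed_field,banach})" "airy_g 0 = (0::'a)" "airy_g' 0 = (1::'a)"
  by (simp_all add: airy_f_eq airy_g_eq airy_g'_def powser_zero airy_coeff_def diffs_def)

section \<open>Wronskians and uniqueness of the coefficients of the Airy functions\<close>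

lemma wronskian_airy_f_g:
  "airy_f x * airy_g' x - airy_f' x * airy_g x = (1::'a::{real_normed_field,banach})"
proof -
  \<comment> \<open>The derivative is f g'' - f'' g = x f g - x f g = 0. The constant is then found
    at 0, where g vanishes.\<close>
  have "((\<lambda>x. airy_f x * airy_g' x - airy_f' x * airy_g x) has_field_derivative 0) (at x within UNIV)"
    for x :: 'a
    by (rule derivative_eq_intros DERIV_airy refl)+ (simp add: algebra_simps)
  then have "\<exists>c. \<forall>x::'a\<in>UNIV. airy_f x * airy_g' x - airy_f' x * airy_g x = c"
    by (intro has_field_derivative_zero_constant) auto
  then show ?thesis
    using airy_at_0 by (metis UNIV_I diff_zero mult.right_neutral mult_zero_right)
qed

lemma DERIV_airy_combination:
  fixes a b :: "'a::{real_normed_field,banach}"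
  assumes "\<And>x. y x = a * airy_f x + b * airy_g x"
  shows "deriv y x = a * airy_f' x + b * airy_g' x"
    and "(y has_field_derivative deriv y x) (at x)"
    and "(deriv y has_field_derivative x * y x) (at x)"
proof -
  have y: "y = (\<lambda>x. a * airy_f x + b * airy_g x)" using assms by auto
  have D: "(y has_field_derivative a * airy_f' x + b * airy_g' x) (at x)" for x
    unfolding y by (rule derivative_eq_intros DERIV_airy refl)+ (simp add: algebra_simps)
  have y': "deriv y x = a * airy_f' x + b * airy_g' x" for x
    by (rule DERIV_imp_deriv[OF D])
  show "deriv y x = a * airy_f' x + b * airy_g' x" by (rule y')
  show "(y has_field_derivative deriv y x) (at x)" unfolding y' by (rule D)
  have "deriv y = (\<lambda>x. a * airy_f' x + b * airy_g' x)" using y' by auto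
  moreover have "((\<lambda>x. a * airy_f' x + b * airy_g' x) has_field_derivative x * y x) (at x)"
    unfolding y by (rule derivative_eq_intros DERIV_airy refl)+ (simp add: algebra_simps)
  ultimately show "(deriv y has_field_derivative x * y x) (at x)" by simp
qed

text \<open>Moves the minus sign into the coefficient, giving the form a f + b g that
  \<open>DERIV_airy_combination\<close> expects.\<close>

lemma Ai_combination:
  "Ai x = of_real (1 / (3 powr (2 / 3) * Gamma (2 / 3))) * airy_f x
     + (- of_real (1 / (3 powr (1 / 3) * Gamma (1 / 3)))) * airy_g x"
  by (simp only: Ai_def mult_minus_left diff_conv_add_uminus)

lemmas DERIV_Ai = DERIV_airy_combination[OF Ai_combination]
lemmas DERIV_Bi = DERIV_airy_combination[OF Bi_def]

text \<open>By bilinearity the Wronskian is the determinant a d + b c of the change of basis times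
  the Wronskian 1 of f and g. Its classical value is 1/pi; positivity of Gamma at 1/3 and 2/3
  already gives that it is nonzero.\<close>

lemma wronskian_Ai_Bi: "Ai x * deriv Bi x - deriv Ai x * Bi x \<noteq> (0::'a::{real_normed_field,banach})"
proof -
  define a b c d :: real where
    "a = 1 / (3 powr (2 / 3) * Gamma (2 / 3))" and "b = 1 / (3 powr (1 / 3) * Gamma (1 / 3))" and
    "c = 1 / (3 powr (1 / 6) * Gamma (2 / 3))" and "d = 3 powr (1 / 6) / Gamma (1 / 3)"
  have pos: "a > 0" "b > 0" "c > 0" "d > 0"
    by (simp_all add: a_def b_def c_def d_def Gamma_real_pos)
  have "Ai x * deriv Bi x - deriv Ai x * Bi x =
      (of_real a * airy_f x - of_real b * airy_g x) * (of_real c * airy_f' x + of_real d * airy_g' x)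
      - (of_real a * airy_f' x - of_real b * airy_g' x) * (of_real c * airy_f x + of_real d * airy_g x)"
    unfolding DERIV_Ai(1) DERIV_Bi(1) unfolding Ai_def Bi_def a_def b_def c_def d_def by simp
  also have "\<dots> = (of_real a * of_real d + of_real b * of_real c) *
      (airy_f x * airy_g' x - airy_f' x * airy_g x)"
    by (simp add: algebra_simps)
  also have "\<dots> = of_real (a * d + b * c)"
    by (simp add: wronskian_airy_f_g)
  also have "\<dots> \<noteq> 0"
    unfolding of_real_eq_0_iff using pos by (smt (verit) mult_pos_pos)
  finally show ?thesis .
qed

text \<open>Cramer's rule at a fixed point: the differences a - c and b - d solve a homogeneous 2 by
  2 system whose determinant is the Wronskian.\<close>

lemma Ai_Bi_coeff_unique:
  fixes a b c d x :: "'a::{real_normed_field,banach}"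
  assumes 1: "a * Ai x + b * deriv Ai x = c * Ai x + d * deriv Ai x"
    and 2: "a * Bi x + b * deriv Bi x = c * Bi x + d * deriv Bi x"
  shows "a = c" and "b = d"
proof -
  define w where "w = Ai x * deriv Bi x - deriv Ai x * Bi x"
  have eq1: "(a - c) * Ai x + (b - d) * deriv Ai x = 0" using 1 by (simp add: algebra_simps)
  have eq2: "(a - c) * Bi x + (b - d) * deriv Bi x = 0" using 2 by (simp add: algebra_simps)
  have "(a - c) * w = ((a - c) * Ai x + (b - d) * deriv Ai x) * deriv Bi x
      - ((a - c) * Bi x + (b - d) * deriv Bi x) * deriv Ai x"
    by (simp add: w_def algebra_simps)
  then show "a = c" using wronskian_Ai_Bi[of x] unfolding eq1 eq2 by (simp add: w_def)
  have "(b - d) * w = ((a - c) * Bi x + (b - d) * deriv Bi x) * Ai x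
      - ((a - c) * Ai x + (b - d) * deriv Ai x) * Bi x"
    by (simp add: w_def algebra_simps)
  then show "b = d" using wronskian_Ai_Bi[of x] unfolding eq1 eq2 by (simp add: w_def)
qed

section \<open>The recurrences for P and Q\<close>

lemma deriv_poly_combination:
  fixes p q :: "'a::{real_normed_field,banach} poly"
  assumes "(y has_field_derivative y' x) (at x)" and "(y' has_field_derivative x * y x) (at x)"
  shows "deriv (\<lambda>x. poly p x * y x + poly q x * y' x) x =
    poly (pderiv p + [:0, 1:] * q) x * y x + poly (p + pderiv q) x * y' x"
proof (rule DERIV_imp_deriv)
  have "((\<lambda>x. poly p x * y x + poly q x * y' x) has_field_derivative
      (poly (pderiv p) x * y x + y' x * poly p x) + (poly (pderiv q) x * y' x + (x * y x) * poly q x)) (at x)"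
    by (intro DERIV_add DERIV_mult assms poly_DERIV)
  then show "((\<lambda>x. poly p x * y x + poly q x * y' x) has_field_derivative
      poly (pderiv p + [:0, 1:] * q) x * y x + poly (p + pderiv q) x * y' x) (at x)"
    by (simp add: algebra_simps)
qed

text \<open>Differentiating the representation of the n-th derivative gives a second representation
  of the next one. Uniqueness at every point equates the values, and equal polynomial functions are
  equal polynomials here.\<close>

lemma airy_poly_rec:
  fixes P Q :: "nat \<Rightarrow> 'a::{real_normed_field,banach} poly"
  assumes Ai: "\<And>n x. (deriv ^^ n) Ai x = poly (P n) x * Ai x + poly (Q n) x * deriv Ai x"
    and Bi: "\<And>n x. (deriv ^^ n) Bi x = poly (P n) x * Bi x + poly (Q n) x * deriv Bi x"
  shows "P 0 = 1" and "Q 0 = 0"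
    and "P (Suc n) = pderiv (P n) + [:0, 1:] * Q n" and "Q (Suc n) = P n + pderiv (Q n)"
proof -
  have "poly (P 0) x = poly 1 x \<and> poly (Q 0) x = poly 0 x" for x
    by (intro conjI Ai_Bi_coeff_unique[of "poly (P 0) x" x "poly (Q 0) x" "poly 1 x" "poly 0 x"])
       (simp_all add: Ai[of 0, symmetric, simplified] Bi[of 0, symmetric, simplified])
  then show "P 0 = 1" "Q 0 = 0"
    by (simp_all only: poly_eq_poly_eq_iff[symmetric] fun_eq_iff simp_thms)
  have A: "(deriv ^^ Suc n) Ai x = poly (pderiv (P n) + [:0, 1:] * Q n) x * Ai x
      + poly (P n + pderiv (Q n)) x * deriv Ai x" for x
  proof -
    have "(deriv ^^ n) Ai = (\<lambda>x. poly (P n) x * Ai x + poly (Q n) x * deriv Ai x)"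
      using Ai by auto
    then show ?thesis
      by (simp add: deriv_poly_combination[OF DERIV_Ai(2,3)] del: poly_add poly_mult)
  qed
  have B: "(deriv ^^ Suc n) Bi x = poly (pderiv (P n) + [:0, 1:] * Q n) x * Bi x
      + poly (P n + pderiv (Q n)) x * deriv Bi x" for x
  proof -
    have "(deriv ^^ n) Bi = (\<lambda>x. poly (P n) x * Bi x + poly (Q n) x * deriv Bi x)"
      using Bi by auto
    then show ?thesis
      by (simp add: deriv_poly_combination[OF DERIV_Bi(2,3)] del: poly_add poly_mult)
  qed
  have "poly (P (Suc n)) x = poly (pderiv (P n) + [:0, 1:] * Q n) x \<and>
      poly (Q (Suc n)) x = poly (P n + pderiv (Q n)) x" for x
    using Ai_Bi_coeff_unique[OF A[of x, unfolded Ai] B[of x, unfolded Bi]] by blast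
  then show "P (Suc n) = pderiv (P n) + [:0, 1:] * Q n" "Q (Suc n) = P n + pderiv (Q n)"
    by (simp_all only: poly_eq_poly_eq_iff[symmetric] fun_eq_iff simp_thms)
qed

section \<open>The Gegenbauer coefficients\<close>

abbreviation phi :: "real fps" where
  "phi \<equiv> 1 - fps_X + fps_const (1 / 3) * fps_X ^ 2"

text \<open>Substituting t / sqrt 3 for t produces the factor sqrt 3 ^ (- n) on the coefficients and
  turns t^2 - sqrt 3 t into t^2 / 3 - t, that is, 1 + u into \<open>phi\<close>.\<close>

lemma g_tilde_eq: "g_tilde m (int n) = fps_nth (inverse phi ^ (m + 1)) n"
proof -
  define u :: "real fps" where "u = fps_X ^ 2 - fps_const (2 * (sqrt 3 / 2)) * fps_X"
  define s :: "real fps" where "s = fps_const (1 / sqrt 3) * fps_X"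
  have u0: "fps_nth u 0 = 0" and s0: "fps_nth s 0 = 0"
    by (simp_all add: u_def s_def)
  have us: "u oo s = fps_const (1 / 3) * fps_X ^ 2 - fps_X"
    using s0
    by (simp add: u_def s_def fps_compose_sub_distrib fps_compose_mult_distrib power_mult_distrib
        fps_compose_power[symmetric] fps_const_power power_divide
        mult.assoc[symmetric] del: fps_const_mult)
  \<comment> \<open>Since the exponent is a negative integer, the binomial series is a power of
    \<open>inverse (1 + fps_X)\<close>, and composition passes through powers and inverses.\<close>
  have "- real m - 1 = - of_nat (m + 1)" by simp
  then have "fps_binomial (- (real m + 1)) = inverse (1 + fps_X) ^ (m + 1)"
    using fps_binomial_minus_of_nat[of "m + 1", where 'a = real]
    by (simp only: minus_add_distrib diff_conv_add_uminus[symmetric] fps_inverse_power)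
  moreover have "fps_nth (u oo s) 0 = 0" and "fps_nth (1 + fps_X :: real fps) 0 \<noteq> 0"
    by (simp_all add: us)
  then have "(inverse (1 + fps_X) ^ (m + 1)) oo (u oo s) = inverse (1 + (u oo s)) ^ (m + 1)"
    by (simp add: fps_compose_power[symmetric] fps_inverse_compose fps_compose_add_distrib
        del: power_Suc)
  ultimately have "(fps_binomial (- (real m + 1)) oo u) oo s = inverse phi ^ (m + 1)"
    unfolding fps_compose_assoc[OF s0 u0, symmetric] by (simp add: us algebra_simps)
  then have "fps_nth (inverse phi ^ (m + 1)) n = (1 / sqrt 3) ^ n * fps_nth (fps_binomial (- (real m + 1)) oo u) n"
    unfolding s_def by (metis fps_nth_compose_linear)
  then show ?thesis
    by (simp add: g_tilde_def gegenbauer_def u_def power_divide)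
qed

lemma g_tilde_neg: "k < 0 \<Longrightarrow> g_tilde m k = 0"
  by (simp add: g_tilde_def)

lemma g_tilde_0_0: "g_tilde 0 0 = 1"
  using g_tilde_eq[of 0 0] by simp

lemma phi_identity:
  "of_nat (Suc k) * ((1 - fps_X) ^ 2 * inverse phi ^ (k + 2)) =
     of_nat (Suc k) * inverse phi ^ (k + 1) - fps_X * fps_deriv (inverse phi ^ (k + 1))"
proof -
  define i where "i = inverse phi"
  define d where "d = fps_deriv phi"
  have i: "phi * i = 1"
    unfolding i_def by (rule inverse_mult_eq_1') simp
  have d_eq: "d = fps_const (2 / 3) * fps_X - 1"
    by (simp add: d_def fps_deriv_power numeral_fps_const mult.assoc[symmetric])
  \<comment> \<open>The quadratic coefficients 1/3 and 2/3 add up to 1, which completes the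
    square.\<close>
  have "phi + fps_X * d = 1 - 2 * fps_X + (fps_const (1 / 3) + fps_const (2 / 3)) * fps_X ^ 2"
    unfolding d_eq by (simp add: power2_eq_square algebra_simps del: fps_const_add)
  then have d: "phi + fps_X * d = (1 - fps_X) ^ 2"
    by (simp add: power2_eq_square algebra_simps)
  have "fps_deriv i = - d * i ^ 2"
    unfolding i_def d_def by (rule fps_inverse_deriv) simp
  then have di: "fps_deriv (i ^ (k + 1)) = - of_nat (Suc k) * d * i ^ (k + 2)"
    using fps_deriv_power[of i "k + 1"]
    by (simp add: fps_of_nat power2_eq_square mult_ac del: of_nat_Suc)
  \<comment> \<open>Inserting \<open>phi * i = 1\<close> raises the first power to k + 2, so that it
    combines with the derivative term.\<close>
  have "of_nat (Suc k) * i ^ (k + 1) - fps_X * fps_deriv (i ^ (k + 1)) =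
      of_nat (Suc k) * ((phi * i) * i ^ (k + 1) + fps_X * d * i ^ (k + 2))"
    unfolding i di by (simp add: algebra_simps)
  also have "\<dots> = of_nat (Suc k) * ((phi + fps_X * d) * i ^ (k + 2))"
    by (simp add: algebra_simps)
  finally show ?thesis unfolding d i_def by simp
qed

text \<open>Coefficient of t^j in \<open>phi_identity\<close>, with m = \<open>Suc k\<close>. An
  integer j lets the shifts j - 1 and j - 2 run below 0.\<close>

lemma g_tilde_rec:
  "real (Suc k) * (g_tilde (Suc k) j - 2 * g_tilde (Suc k) (j - 1) + g_tilde (Suc k) (j - 2)) =
     (real (Suc k) - of_int j) * g_tilde k j"
proof (cases "j < 0")
  case True
  then show ?thesis by (simp add: g_tilde_neg)
next
  case False
  then obtain n where j: "j = int n" by (metis not_less nonneg_int_cases)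
  define A where "A = inverse phi ^ (k + 2)"
  define B where "B = inverse phi ^ (k + 1)"
  have 0: "g_tilde (Suc k) (int m) = fps_nth A m" for m
    using g_tilde_eq[of "Suc k" m] by (simp add: A_def)
  \<comment> \<open>The value 0 at negative indices agrees with the vanishing low coefficients of
    \<open>fps_X * A\<close> and \<open>fps_X * (fps_X * A)\<close>.\<close>
  have 1: "g_tilde (Suc k) (int n - 1) = fps_nth (fps_X * A) n"
    using 0[of "n - 1"] by (cases n) (simp_all add: g_tilde_neg)
  have 2: "g_tilde (Suc k) (int n - 2) = fps_nth (fps_X * (fps_X * A)) n"
    using 0[of "n - 2"] by (cases n; cases "n - 1") (simp_all add: g_tilde_neg)
  have B: "g_tilde k (int n) = fps_nth B n"
    by (simp add: g_tilde_eq B_def)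
  have D: "fps_nth (fps_X * fps_deriv B) n = real n * fps_nth B n"
    by (cases n) simp_all
  have "fps_const (real (Suc k)) * (A - fps_const 2 * (fps_X * A) + fps_X * (fps_X * A)) =
      of_nat (Suc k) * ((1 - fps_X) ^ 2 * A)"
    by (simp add: power2_eq_square algebra_simps fps_of_nat[symmetric] numeral_fps_const
        del: of_nat_Suc)
  also have "\<dots> = fps_const (real (Suc k)) * B - fps_X * fps_deriv B"
    unfolding A_def B_def phi_identity by (simp add: fps_of_nat del: of_nat_Suc)
  finally have "fps_nth (fps_const (real (Suc k)) * (A - fps_const 2 * (fps_X * A) + fps_X * (fps_X * A))) n
      = fps_nth (fps_const (real (Suc k)) * B - fps_X * fps_deriv B) n"
    by simp
  then have "real (Suc k) * (fps_nth A n - 2 * fps_nth (fps_X * A) n + fps_nth (fps_X * (fps_X * A)) n) =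
      real (Suc k) * fps_nth B n - real n * fps_nth B n"
    by (simp only: fps_mult_left_const_nth fps_add_nth fps_sub_nth D)
  then show ?thesis
    unfolding j 0 1 2 B by (simp add: algebra_simps)
qed

section \<open>Coefficients of the polynomials\<close>

text \<open>Simultaneous induction, with i = 3 m - n for P and i = 3 m + 1 - n for Q: here Q carries
  the index n, not n + 1 as in the theorem. The bound m \<le> n / 2 can be left out, because
  \<open>g_tilde\<close> is 0 at negative indices.\<close>

lemma airy_poly_coeff:
  fixes P Q :: "nat \<Rightarrow> 'a::{real_normed_field,banach} poly"
  assumes P0: "P 0 = 1" and Q0: "Q 0 = 0"
    and PS: "\<And>n. P (Suc n) = pderiv (P n) + [:0, 1:] * Q n"
    and QS: "\<And>n. Q (Suc n) = P n + pderiv (Q n)"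
  shows "(\<forall>i m. n + i = 3 * m \<longrightarrow> coeff (P n) i =
            of_real (g_tilde m (int n - 2 * int m) - g_tilde m (int n - 2 * int m - 1)) * (fact m / fact i))
       \<and> (\<forall>i. \<not> 3 dvd n + i \<longrightarrow> coeff (P n) i = 0)
       \<and> (\<forall>i m. n + i = 3 * m + 1 \<longrightarrow> coeff (Q n) i =
            of_real (g_tilde m (int n - 2 * int m - 1)) * (fact m / fact i))
       \<and> (\<forall>i. (n + i) mod 3 \<noteq> 1 \<longrightarrow> coeff (Q n) i = 0)"
proof (induction n)
  case 0
  show ?case
  proof (intro conjI allI impI)
    fix i m :: nat assume "0 + i = 3 * m"
    then show "coeff (P 0) i =
        of_real (g_tilde m (int 0 - 2 * int m) - g_tilde m (int 0 - 2 * int m - 1)) * (fact m / fact i)"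
      by (cases m) (simp_all add: P0 g_tilde_neg g_tilde_0_0)
  next
    fix i :: nat assume "\<not> 3 dvd 0 + i"
    then show "coeff (P 0) i = 0" by (cases i) (simp_all add: P0)
  qed (simp_all add: Q0 g_tilde_neg)
next
  case (Suc n)
  have Pn: "coeff (P n) i =
      of_real (g_tilde m (int n - 2 * int m) - g_tilde m (int n - 2 * int m - 1)) * (fact m / fact i)"
    if "n + i = 3 * m" for i m using Suc that by blast
  have Pn0: "coeff (P n) i = 0" if "\<not> 3 dvd n + i" for i using Suc that by blast
  have Qn: "coeff (Q n) i = of_real (g_tilde m (int n - 2 * int m - 1)) * (fact m / fact i)"
    if "n + i = 3 * m + 1" for i m using Suc that by blast
  have Qn0: "coeff (Q n) i = 0" if "(n + i) mod 3 \<noteq> 1" for i using Suc that by blast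
  have cP: "coeff (P (Suc n)) i =
      of_nat (Suc i) * coeff (P n) (Suc i) + (if i = 0 then 0 else coeff (Q n) (i - 1))" for i
    by (simp add: PS coeff_pderiv coeff_pCons split: nat.split)
  have cQ: "coeff (Q (Suc n)) i = coeff (P n) i + of_nat (Suc i) * coeff (Q n) (Suc i)" for i
    by (simp add: QS coeff_pderiv)
  have fS: "of_nat (Suc i) * (z * (w / fact (Suc i))) = z * (w / (fact i :: 'a))" for i and z w :: 'a
  proof -
    have "of_nat (Suc i) \<noteq> (0::'a)" by (simp only: of_nat_eq_0_iff)
    then show ?thesis by (simp del: of_nat_Suc)
  qed
  show ?case
  proof (intro conjI allI impI)
    fix i m :: nat assume im: "Suc n + i = 3 * m"
    then obtain k where k: "m = Suc k" by (cases m) auto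
    define j where "j = int (Suc n) - 2 * int m"
    \<comment> \<open>The factor m - j of \<open>g_tilde_rec\<close> is 3 m - (n + 1), the exponent
      i.\<close>
    have ji: "real (Suc k) - of_int j = real i"
      using im unfolding j_def k by (simp; linarith)
    have j1: "int n - 2 * int m = j - 1" "int n - 2 * int m - 1 = j - 2"
      "int n - 2 * int k - 1 = j"
      by (simp_all add: j_def k)
    have 1: "of_nat (Suc i) * coeff (P n) (Suc i) =
        of_real (g_tilde m (j - 1) - g_tilde m (j - 2)) * (fact m / fact i)"
      using im by (subst Pn[of "Suc i" m]) (simp, simp only: fS j1(1), simp)
    \<comment> \<open>Multiplication by x lowers m to k = m - 1, since n + (i - 1) = 3 k + 1. The
      factor i turns \<open>fact (i - 1)\<close> into \<open>fact i\<close>; at i = 0 both sides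
      vanish.\<close>
    have 2: "(if i = 0 then 0 else coeff (Q n) (i - 1)) =
        of_real (real i * g_tilde k j) * (fact k / (fact i :: 'a))"
    proof (cases i)
      case (Suc l)
      then have "coeff (Q n) (i - 1) = of_real (g_tilde k j) * (fact k / fact l)"
        using im k Qn[of l k] by (simp add: j1)
      then show ?thesis
        unfolding Suc using fS[of l "of_real (g_tilde k j)" "fact k"]
        by (simp add: mult_ac del: of_nat_Suc fact_Suc)
    qed simp
    have 3: "real i * g_tilde k j = real (Suc k) * (g_tilde m j - 2 * g_tilde m (j - 1) + g_tilde m (j - 2))"
      unfolding k g_tilde_rec ji ..
    \<comment> \<open>By \<open>3\<close> the Q term carries the second difference, whose factor m
      turns \<open>fact k\<close> into \<open>fact m\<close>. Adding the P term leaves a first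
      difference.\<close>
    have "coeff (P (Suc n)) i = of_real (g_tilde m (j - 1) - g_tilde m (j - 2)) * (fact m / fact i)
        + of_real (g_tilde m j - 2 * g_tilde m (j - 1) + g_tilde m (j - 2)) * (fact m / fact i)"
      unfolding cP 1 2 3 by (simp add: k mult_ac del: of_nat_Suc)
    also have "\<dots> = of_real (g_tilde m j - g_tilde m (j - 1)) * (fact m / fact i)"
      by (simp only: distrib_right[symmetric] of_real_add[symmetric]) simp
    finally show "coeff (P (Suc n)) i =
        of_real (g_tilde m (int (Suc n) - 2 * int m) - g_tilde m (int (Suc n) - 2 * int m - 1))
          * (fact m / fact i)"
      unfolding j_def .
  next
    fix i :: nat assume i: "\<not> 3 dvd Suc n + i"
    then have "coeff (P n) (Suc i) = 0" by (intro Pn0) simp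
    moreover have "coeff (Q n) (i - 1) = 0" if "i \<noteq> 0"
    proof -
      obtain l where l: "i = Suc l" using \<open>i \<noteq> 0\<close> by (cases i) auto
      \<comment> \<open>Here n + l is two less than \<open>Suc n + i\<close>.\<close>
      have "(n + l) mod 3 \<noteq> 1"
        using i unfolding l by presburger
      then show ?thesis using Qn0[of l] by (simp add: l)
    qed
    ultimately show "coeff (P (Suc n)) i = 0" by (simp add: cP)
  next
    fix i m :: nat assume "Suc n + i = 3 * m + 1"
    then have im: "n + i = 3 * m" by simp
    have "coeff (Q (Suc n)) i =
        of_real (g_tilde m (int n - 2 * int m) - g_tilde m (int n - 2 * int m - 1)) * (fact m / fact i)
        + of_real (g_tilde m (int n - 2 * int m - 1)) * (fact m / fact i)"
      unfolding cQ using im by (subst Pn[of i m], simp, subst Qn[of "Suc i" m]) (simp, simp only: fS)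
    also have "\<dots> = of_real (g_tilde m (int n - 2 * int m)) * (fact m / fact i)"
      by (simp add: algebra_simps)
    finally show "coeff (Q (Suc n)) i =
        of_real (g_tilde m (int (Suc n) - 2 * int m - 1)) * (fact m / fact i)"
      by simp
  next
    fix i :: nat assume i: "(Suc n + i) mod 3 \<noteq> 1"
    then have "coeff (P n) i = 0" by (intro Pn0) presburger
    moreover have "coeff (Q n) (Suc i) = 0" using i by (intro Qn0) simp
    ultimately show "coeff (Q (Suc n)) i = 0" by (simp add: cQ)
  qed
qed

text \<open>Turns coefficient formulas into the stated sums: each exponent i with 3 dividing n + i
  comes from exactly one m, and \<open>h0\<close> removes those m above n / 2.\<close>

lemma poly_eq_sum_residue_class:
  fixes p :: "'a::field_char_0 poly"
  assumes p: "\<And>i m. n + i = 3 * m \<Longrightarrow> coeff p i = h m * (fact m / fact i)"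
    and p0: "\<And>i. \<not> 3 dvd n + i \<Longrightarrow> coeff p i = 0"
    and h0: "\<And>m. n < 2 * m \<Longrightarrow> h m = 0"
  shows "poly p x = (\<Sum>m | real n / 3 \<le> real m \<and> real m \<le> real n / 2.
     h m * (fact m * x ^ (3 * m - n) / fact (3 * m - n)))"
proof -
  define S where "S = {m. real n / 3 \<le> real m \<and> real m \<le> real n / 2}"
  \<comment> \<open>On \<open>S\<close> the natural subtraction 3 m - n is exact, so 3 m - n = i
    means n + i = 3 m.\<close>
  have S: "m \<in> S \<longleftrightarrow> n \<le> 3 * m \<and> 2 * m \<le> n" for m
    unfolding S_def by (simp add: field_simps; linarith)
  have fin: "finite S"
    by (rule finite_subset[of _ "{..n}"]) (auto simp: S)
  have "p = (\<Sum>m\<in>S. monom (h m * (fact m / fact (3 * m - n))) (3 * m - n))"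
  proof (rule poly_eqI)
    fix i
    have "coeff (\<Sum>m\<in>S. monom (h m * (fact m / fact (3 * m - n))) (3 * m - n)) i =
        (\<Sum>m\<in>S. if n + i = 3 * m then h m * (fact m / fact i) else 0)"
      unfolding coeff_sum coeff_monom by (rule sum.cong) (auto simp: S)
    also have "\<dots> = coeff p i"
    proof (cases "3 dvd n + i")
      case True
      then obtain k where k: "n + i = 3 * k" by (elim dvdE)
      have "(\<Sum>m\<in>S. if n + i = 3 * m then h m * (fact m / fact i) else 0) =
          (\<Sum>m\<in>S. if k = m then h m * (fact m / fact i) else 0)"
        by (simp add: k)
      also have "\<dots> = coeff p i"
        \<comment> \<open>As n \<le> 3 k holds anyway, k can lie outside \<open>S\<close> only if n
          < 2 k, and then both sides are 0.\<close>
        using fin p[OF k] h0[of k] k by (auto simp: S)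
      finally show ?thesis .
    next
      case False
      then have "(\<Sum>m\<in>S. if n + i = 3 * m then h m * (fact m / fact i) else 0) = 0"
        by (intro sum.neutral) (auto simp: dvd_def)
      then show ?thesis using p0[OF False] by simp
    qed
    finally show "coeff p i = coeff (\<Sum>m\<in>S. monom (h m * (fact m / fact (3 * m - n))) (3 * m - n)) i" ..
  qed
  then have "poly p x = poly (\<Sum>m\<in>S. monom (h m * (fact m / fact (3 * m - n))) (3 * m - n)) x"
    by simp
  then show ?thesis
    unfolding S_def[symmetric] by (simp add: poly_sum poly_monom mult_ac)
qed

theorem mainTheorem1:
  fixes P Q :: "nat \<Rightarrow> 'a::{real_normed_field,banach} poly"
  assumes "\<And>n x. (deriv ^^ n) Ai x = poly (P n) x * Ai x + poly (Q n) x * deriv Ai x"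
    and "\<And>n x. (deriv ^^ n) Bi x = poly (P n) x * Bi x + poly (Q n) x * deriv Bi x"
  shows "\<forall>n x. poly (Q (n + 1)) x =
            (\<Sum>m | real n / 3 \<le> real m \<and> real m \<le> real n / 2.
               of_real (g_tilde m (int n - 2 * int m))
                 * (fact m * x ^ (3 * m - n) / fact (3 * m - n)))
          \<and> poly (P n) x =
            (\<Sum>m | real n / 3 \<le> real m \<and> real m \<le> real n / 2.
               of_real (g_tilde m (int n - 2 * int m) - g_tilde m (int n - 2 * int m - 1))
                 * (fact m * x ^ (3 * m - n) / fact (3 * m - n)))"
proof (intro allI conjI)
  fix n x
  note coeffs = airy_poly_coeff[of P Q, OF airy_poly_rec[OF assms]]
  \<comment> \<open>The shift to \<open>Suc n\<close> makes Suc n + i = 3 m + 1 the same condition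
    as for P, and the second index becomes n - 2 m.\<close>
  have Q1: "coeff (Q (Suc n)) i = of_real (g_tilde m (int n - 2 * int m)) * (fact m / fact i)"
    if "n + i = 3 * m" for i m
    using coeffs[of "Suc n"] that by simp
  have Q2: "coeff (Q (Suc n)) i = 0" if "\<not> 3 dvd n + i" for i
  proof -
    have "(Suc n + i) mod 3 \<noteq> 1" using that by presburger
    then show ?thesis using coeffs[of "Suc n"] by blast
  qed
  show "poly (Q (n + 1)) x =
      (\<Sum>m | real n / 3 \<le> real m \<and> real m \<le> real n / 2.
         of_real (g_tilde m (int n - 2 * int m)) * (fact m * x ^ (3 * m - n) / fact (3 * m - n)))"
    using Q1 Q2 by (intro poly_eq_sum_residue_class) (auto simp: g_tilde_neg)
  show "poly (P n) x =
      (\<Sum>m | real n / 3 \<le> real m \<and> real m \<le> real n / 2.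
         of_real (g_tilde m (int n - 2 * int m) - g_tilde m (int n - 2 * int m - 1))
           * (fact m * x ^ (3 * m - n) / fact (3 * m - n)))"
    using coeffs[of n] by (intro poly_eq_sum_residue_class) (blast, blast, simp add: g_tilde_neg)
qed

end
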